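(* Let $C$ be a commutative unital ring and $n\ge 1$. The $S_n$-module $C[\varepsilon]_n$ is a free $C$-module of rank $2^{n-1}$.
   Context: $C[\varepsilon]$ denotes the commutative unital $C$-algebra $C[\theta,\varepsilon_1,\varepsilon_2,\dots]$ subject to the relations $\theta^2=2$ and $\varepsilon_i^2=\theta\varepsilon_i$ for all $i$. For $\sigma\in S_n$ let $\phi_\sigma$ be the $C$-algebra automorphism of $C[\varepsilon]$ with $\phi_\sigma(\theta)=\theta$ and $\phi_\sigma(\varepsilon_i)=\varepsilon_{\sigma(i)}$ (with $\sigma(i)=i$ for $i>n$). For $w=(e_1,\dots,e_n)$ (a tuple of generators of the generalized Grassmann algebra), the generalized sign of $\sigma\in S_n$ is $$\mathfrak{sgn}_w(\sigma)=\prod_{i<j,\ \sigma(i)>\sigma(j)}\bigl(1-\varepsilon_{\sigma(i)}\varepsilon_{\sigma(j)}\bigr)\in C[\varepsilon].$$ $S_n$ acts $C$-linearly on $C[\varepsilon]$ by $\sigma(\lambda)=\mathfrak{sgn}_w(\sigma)\,\phi_\sigma(\lambda)$ (this is a group action), and $C[\varepsilon]_n$ is the $S_n$-submodule (i.e. $C[S_n]$-submodule) of $C[\varepsilon]$ generated by $1\in C[\varepsilon]$; equivalently, the $C$-span of the elements $\mathfrak{sgn}_w(\sigma)$, $\sigma\in S_n$. *)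

theory Defs
  imports Complex_Main "HOL-Library.Poly_Mapping" "HOL-Combinatorics.Permutations"
begin

text \<open>
  Polynomials are the monoid algebra over monomials \<open>gen \<Rightarrow>\<^sub>0 nat\<close>. The generator \<open>Eps i\<close> stands for
  $\varepsilon_{i+1}$, so indices start at 0 and $S_n$ is the set of permutations of \<open>{..<n}\<close>.
\<close>

datatype gen = Theta | Eps nat

type_synonym 'c gpoly = "(gen \<Rightarrow>\<^sub>0 nat) \<Rightarrow>\<^sub>0 'c"

definition Var :: "gen \<Rightarrow> 'c::comm_ring_1 gpoly" where
  "Var x = Poly_Mapping.single (Poly_Mapping.single x 1) 1"

definition eps_relations :: "'c::comm_ring_1 gpoly set" where
  "eps_relations = insert (Var Theta ^ 2 - 2)
     (range (\<lambda>i. Var (Eps i) ^ 2 - Var Theta * Var (Eps i)))"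

text \<open>The ideal generated by a set is its span in the ring regarded as a module over itself.\<close>

abbreviation eps_ideal :: "'c::comm_ring_1 gpoly set" where
  "eps_ideal \<equiv> module.span (*) eps_relations"

interpretation gpoly_mod: module "(*) :: 'c::comm_ring_1 gpoly \<Rightarrow> 'c gpoly \<Rightarrow> 'c gpoly"
  by unfold_locales (simp_all add: algebra_simps)

quotient_type (overloaded) 'c eps_alg =
  "'c::comm_ring_1 gpoly" / "\<lambda>p q. p - q \<in> eps_ideal"
proof (rule equivpI)
  show "reflp (\<lambda>p q. p - q \<in> (eps_ideal :: 'c gpoly set))"
    by (auto intro!: reflpI gpoly_mod.span_zero)
  show "symp (\<lambda>p q. p - q \<in> (eps_ideal :: 'c gpoly set))"
    by (metis (no_types, lifting) gpoly_mod.span_neg minus_diff_eq sympI)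
  show "transp (\<lambda>p q. p - q \<in> (eps_ideal :: 'c gpoly set))"
  proof (rule transpI)
    fix p q r :: "'c gpoly"
    assume "p - q \<in> eps_ideal" "q - r \<in> eps_ideal"
    then have "(p - q) + (q - r) \<in> eps_ideal"
      by (rule gpoly_mod.span_add)
    then show "p - r \<in> eps_ideal"
      by simp
  qed
qed

lemma sum_keys_superset:
  assumes "\<And>m. f m 0 = 0" "finite A" "Poly_Mapping.keys p \<subseteq> A"
  shows "(\<Sum>m\<in>Poly_Mapping.keys p. f m (Poly_Mapping.lookup p m))
    = (\<Sum>m\<in>A. f m (Poly_Mapping.lookup p m))"
  using assms by (intro sum.mono_neutral_left) (auto simp: in_keys_iff)

lemma sum_keys_add:
  fixes f :: "'a \<Rightarrow> 'b::comm_monoid_add \<Rightarrow> 'd::comm_monoid_add"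
  assumes "\<And>m. f m 0 = 0" "\<And>m a b. f m (a + b) = f m a + f m b"
  shows "(\<Sum>m\<in>Poly_Mapping.keys (p + q). f m (Poly_Mapping.lookup (p + q) m))
    = (\<Sum>m\<in>Poly_Mapping.keys p. f m (Poly_Mapping.lookup p m))
      + (\<Sum>m\<in>Poly_Mapping.keys q. f m (Poly_Mapping.lookup q m))"
proof -
  let ?A = "Poly_Mapping.keys p \<union> Poly_Mapping.keys q"
  have "Poly_Mapping.keys (p + q) \<subseteq> ?A"
    by (rule Poly_Mapping.keys_add)
  then show ?thesis
    using sum_keys_superset[of f ?A "p + q"] sum_keys_superset[of f ?A p]
      sum_keys_superset[of f ?A q] assms
    by (simp add: lookup_add sum.distrib)
qed

text \<open>
  Linear extension of a map on basis elements. On monomials \<open>pm_push g\<close> renames the variables;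
  applied once more to this renaming it is the substitution homomorphism on polynomials.
\<close>

definition pm_push :: "('a \<Rightarrow> 'b) \<Rightarrow> ('a \<Rightarrow>\<^sub>0 'c::comm_monoid_add) \<Rightarrow> ('b \<Rightarrow>\<^sub>0 'c)" where
  "pm_push g p = (\<Sum>x\<in>Poly_Mapping.keys p. Poly_Mapping.single (g x) (Poly_Mapping.lookup p x))"

lemma pm_push_single [simp]: "pm_push g (Poly_Mapping.single x c) = Poly_Mapping.single (g x) c"
  by (simp add: pm_push_def)

lemma pm_push_zero [simp]: "pm_push g 0 = 0"
  by (simp add: pm_push_def)

lemma pm_push_add: "pm_push g (p + q) = pm_push g p + pm_push g q"
  unfolding pm_push_def by (rule sum_keys_add) (simp_all add: single_add)

lemma poly_mapping_add_induct [case_names zero single add]: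
  fixes p :: "'a \<Rightarrow>\<^sub>0 'b::comm_monoid_add"
  assumes "P 0" "\<And>m c. P (Poly_Mapping.single m c)" "\<And>p q. P p \<Longrightarrow> P q \<Longrightarrow> P (p + q)"
  shows "P p"
proof -
  have "P (\<Sum>m\<in>A. Poly_Mapping.single m (Poly_Mapping.lookup p m))" if "finite A" for A
    using that by induction (auto intro: assms)
  from this[OF finite_keys]
  have "P (\<Sum>m\<in>Poly_Mapping.keys p. Poly_Mapping.single m (Poly_Mapping.lookup p m))" .
  moreover have "(\<Sum>m\<in>Poly_Mapping.keys p. Poly_Mapping.single m (Poly_Mapping.lookup p m)) = p"
    by (rule poly_mapping_eqI) (simp add: lookup_sum lookup_single when_def in_keys_iff)
  ultimately show ?thesis
    by simp
qed

abbreviation gpoly_subst :: "(gen \<Rightarrow> gen) \<Rightarrow> 'c::comm_ring_1 gpoly \<Rightarrow> 'c gpoly" where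
  "gpoly_subst g \<equiv> pm_push (pm_push g)"

lemma gpoly_subst_mult: "gpoly_subst g (p * q) = gpoly_subst g p * gpoly_subst g q"
proof (induction p rule: poly_mapping_add_induct)
  case (single m c)
  show ?case
    by (induction q rule: poly_mapping_add_induct)
      (simp_all add: mult_single pm_push_add algebra_simps)
qed (simp_all add: pm_push_add algebra_simps)

lemma gpoly_subst_one [simp]: "gpoly_subst g 1 = 1"
  by (simp flip: single_one)

lemma gpoly_subst_uminus: "gpoly_subst g (- p) = - gpoly_subst g p"
  using pm_push_add[of "pm_push g" p "- p"] by (simp add: eq_neg_iff_add_eq_0 add.commute)

lemma gpoly_subst_diff: "gpoly_subst g (p - q) = gpoly_subst g p - gpoly_subst g q"
  using pm_push_add[of "pm_push g" p "- q"] by (simp add: gpoly_subst_uminus)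

lemma gpoly_subst_Var [simp]: "gpoly_subst g (Var x) = Var (g x)"
  by (simp add: Var_def)

lemma gpoly_subst_ideal:
  assumes "g Theta = Theta" "\<And>i. \<exists>j. g (Eps i) = Eps j" "p \<in> eps_ideal"
  shows "gpoly_subst g p \<in> eps_ideal"
  using assms(3)
proof (induction p rule: gpoly_mod.span_induct_alt)
  case base
  show ?case by (simp add: gpoly_mod.span_zero)
next
  case (step c x y)
  have two: "gpoly_subst g (2 :: 'a gpoly) = 2"
    unfolding one_add_one[symmetric] pm_push_add gpoly_subst_one ..
  consider "x = Var Theta ^ 2 - 2" | i where "x = Var (Eps i) ^ 2 - Var Theta * Var (Eps i)"
    using step(1) unfolding eps_relations_def by auto
  then have "gpoly_subst g x \<in> eps_relations"
  proof cases
    case 1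
    then have "gpoly_subst g x = Var Theta ^ 2 - 2"
      using assms(1) by (simp add: gpoly_subst_diff gpoly_subst_mult power2_eq_square two)
    then show ?thesis
      by (simp add: eps_relations_def)
  next
    case (2 i)
    obtain j where "g (Eps i) = Eps j"
      using assms(2) by blast
    then have "gpoly_subst g x = Var (Eps j) ^ 2 - Var Theta * Var (Eps j)"
      using 2 assms(1) by (simp add: gpoly_subst_diff gpoly_subst_mult power2_eq_square)
    then show ?thesis
      by (simp add: eps_relations_def)
  qed
  then show ?case
    unfolding pm_push_add gpoly_subst_mult
    by (intro gpoly_mod.span_add gpoly_mod.span_scale gpoly_mod.span_base step(2))
qed

text \<open>A linear functional vanishing on the ideal and not at 1, so that the quotient is nonzero.\<close>

definition unit_weight :: "(gen \<Rightarrow>\<^sub>0 nat) \<Rightarrow> 'c::comm_ring_1" where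
  "unit_weight m = (if (\<forall>i. Poly_Mapping.lookup m (Eps i) = 0) \<and> even (Poly_Mapping.lookup m Theta)
     then 2 ^ (Poly_Mapping.lookup m Theta div 2) else 0)"

definition unit_coeff :: "'c::comm_ring_1 gpoly \<Rightarrow> 'c" where
  "unit_coeff p = (\<Sum>m\<in>Poly_Mapping.keys p. unit_weight m * Poly_Mapping.lookup p m)"

lemma unit_coeff_add: "unit_coeff (p + q) = unit_coeff p + unit_coeff q"
  unfolding unit_coeff_def by (rule sum_keys_add) (simp_all add: algebra_simps)

lemma unit_coeff_uminus: "unit_coeff (- p) = - unit_coeff p"
  using unit_coeff_add[of p "- p"]
  by (simp add: eq_neg_iff_add_eq_0 add.commute) (simp add: unit_coeff_def)

lemma unit_coeff_diff: "unit_coeff (p - q) = unit_coeff p - unit_coeff q"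
  using unit_coeff_add[of p "- q"] by (simp add: unit_coeff_uminus)

lemma unit_coeff_single [simp]: "unit_coeff (Poly_Mapping.single m c) = unit_weight m * c"
  by (simp add: unit_coeff_def)

lemma unit_coeff_mult_relation:
  assumes "r \<in> eps_relations"
  shows "unit_coeff (p * r) = 0"
proof (induction p rule: poly_mapping_add_induct)
  case (single m c)
  have two: "(2 :: 'a gpoly) = Poly_Mapping.single 0 2"
    unfolding one_add_one[symmetric] single_add single_one ..
  consider "r = Var Theta ^ 2 - 2" | i where "r = Var (Eps i) ^ 2 - Var Theta * Var (Eps i)"
    using assms unfolding eps_relations_def by auto
  then show ?case
  proof cases
    case 1
    have "unit_weight (m + (Poly_Mapping.single Theta (Suc 0) + Poly_Mapping.single Theta (Suc 0)))
      = (2 * unit_weight m :: 'a)"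
      by (auto simp: unit_weight_def lookup_add lookup_single)
    then show ?thesis
      unfolding 1 two
      by (simp add: right_diff_distrib mult_ac unit_coeff_diff Var_def mult_single power2_eq_square
          del: single_numeral)
  next
    case (2 i)
    have "unit_weight (m + (Poly_Mapping.single (Eps i) (Suc 0) + Poly_Mapping.single (Eps i) (Suc 0)))
        = (0::'a)"
      "unit_weight (m + (Poly_Mapping.single Theta (Suc 0) + Poly_Mapping.single (Eps i) (Suc 0)))
        = (0::'a)"
      by (auto simp: unit_weight_def lookup_add lookup_single dest!: spec[of _ i])
    then show ?thesis
      unfolding 2
      by (simp add: right_diff_distrib unit_coeff_diff Var_def mult_single power2_eq_square)
  qed
qed (simp_all add: unit_coeff_add distrib_right unit_coeff_def[of 0])

lemma unit_coeff_ideal: "p \<in> eps_ideal \<Longrightarrow> unit_coeff p = 0"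
  by (induction p rule: gpoly_mod.span_induct_alt)
    (simp_all add: unit_coeff_add unit_coeff_mult_relation unit_coeff_def[of 0])

lemma one_notin_eps_ideal: "1 \<notin> (eps_ideal :: 'c::comm_ring_1 gpoly set)"
proof
  assume "1 \<in> (eps_ideal :: 'c gpoly set)"
  then have "unit_coeff (Poly_Mapping.single 0 1) = (0::'c)"
    unfolding single_one by (rule unit_coeff_ideal)
  then show False
    unfolding unit_coeff_single by (simp add: unit_weight_def)
qed

instantiation eps_alg :: (comm_ring_1) comm_ring_1
begin

lift_definition zero_eps_alg :: "'a eps_alg" is 0 .

lift_definition one_eps_alg :: "'a eps_alg" is 1 .

lift_definition plus_eps_alg :: "'a eps_alg \<Rightarrow> 'a eps_alg \<Rightarrow> 'a eps_alg" is "(+)"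
proof -
  fix p p' q q' :: "'a gpoly"
  assume "p - p' \<in> eps_ideal" "q - q' \<in> eps_ideal"
  then have "(p - p') + (q - q') \<in> eps_ideal"
    by (rule gpoly_mod.span_add)
  then show "p + q - (p' + q') \<in> eps_ideal"
    by (simp add: algebra_simps)
qed

lift_definition minus_eps_alg :: "'a eps_alg \<Rightarrow> 'a eps_alg \<Rightarrow> 'a eps_alg" is "(-)"
proof -
  fix p p' q q' :: "'a gpoly"
  assume "p - p' \<in> eps_ideal" "q - q' \<in> eps_ideal"
  then have "(p - p') - (q - q') \<in> eps_ideal"
    by (rule gpoly_mod.span_diff)
  then show "p - q - (p' - q') \<in> eps_ideal"
    by (simp add: algebra_simps)
qed

lift_definition uminus_eps_alg :: "'a eps_alg \<Rightarrow> 'a eps_alg" is "uminus"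
proof -
  fix p p' :: "'a gpoly"
  assume "p - p' \<in> eps_ideal"
  then have "- (p - p') \<in> eps_ideal"
    by (rule gpoly_mod.span_neg)
  then show "- p - - p' \<in> eps_ideal"
    by simp
qed

lift_definition times_eps_alg :: "'a eps_alg \<Rightarrow> 'a eps_alg \<Rightarrow> 'a eps_alg" is "(*)"
proof -
  fix p p' q q' :: "'a gpoly"
  assume "p - p' \<in> eps_ideal" "q - q' \<in> eps_ideal"
  then have "q * (p - p') + p' * (q - q') \<in> eps_ideal"
    by (intro gpoly_mod.span_add gpoly_mod.span_scale)
  then show "p * q - p' * q' \<in> eps_ideal"
    by (simp add: algebra_simps)
qed

instance
proof
  show "(0 :: 'a eps_alg) \<noteq> 1"
  proof (transfer, rule notI)
    assume "0 - 1 \<in> (eps_ideal :: 'a gpoly set)"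
    then have "- (0 - 1) \<in> (eps_ideal :: 'a gpoly set)"
      by (rule gpoly_mod.span_neg)
    then show False
      by (simp add: one_notin_eps_ideal)
  qed
  fix a b c :: "'a eps_alg"
  show "a * b * c = a * (b * c)"
    by transfer (simp only: mult.assoc diff_self gpoly_mod.span_zero)
  show "a * b = b * a"
    by transfer (subst mult.commute, simp only: diff_self gpoly_mod.span_zero)
  show "1 * a = a"
    by transfer (simp only: mult_1_left diff_self gpoly_mod.span_zero)
  show "a + b + c = a + (b + c)"
    by transfer (simp only: add.assoc diff_self gpoly_mod.span_zero)
  show "a + b = b + a"
    by transfer (subst add.commute, simp only: diff_self gpoly_mod.span_zero)
  show "0 + a = a"
    by transfer (simp only: add_0_left diff_self gpoly_mod.span_zero)
  show "- a + a = 0"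
    by transfer (simp only: left_minus diff_self gpoly_mod.span_zero)
  show "a - b = a + - b"
    by transfer (simp only: add_uminus_conv_diff diff_self gpoly_mod.span_zero)
  show "(a + b) * c = a * c + b * c"
    by transfer (simp only: distrib_right diff_self gpoly_mod.span_zero)
qed

end

lift_definition theta :: "'c::comm_ring_1 eps_alg" is "Var Theta" .

lift_definition eps :: "nat \<Rightarrow> 'c::comm_ring_1 eps_alg" is "\<lambda>i. Var (Eps i)" .

lemma theta_square: "theta ^ 2 = (2 :: 'c::comm_ring_1 eps_alg)"
proof -
  have "theta * theta = (1 + 1 :: 'c eps_alg)"
  proof transfer
    have "(Var Theta ^ 2 - 2 :: 'c gpoly) \<in> eps_ideal"
      by (rule gpoly_mod.span_base) (simp add: eps_relations_def)
    then show "(Var Theta * Var Theta - (1 + 1) :: 'c gpoly) \<in> eps_ideal"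
      by (simp add: power2_eq_square)
  qed
  then show ?thesis
    by (simp add: power2_eq_square)
qed

lemma eps_square: "eps i ^ 2 = (theta * eps i :: 'c::comm_ring_1 eps_alg)"
  unfolding power2_eq_square
  by transfer (rule gpoly_mod.span_base, simp add: eps_relations_def power2_eq_square)

lift_definition eps_const :: "'c::comm_ring_1 \<Rightarrow> 'c eps_alg" is "\<lambda>c. Poly_Mapping.single 0 c" .

definition eps_scale :: "'c::comm_ring_1 \<Rightarrow> 'c eps_alg \<Rightarrow> 'c eps_alg" where
  "eps_scale c x = eps_const c * x"

interpretation eps_mod: module "eps_scale :: 'c::comm_ring_1 \<Rightarrow> 'c eps_alg \<Rightarrow> 'c eps_alg"
proof
  have add: "eps_const (a + b) = eps_const a + eps_const b" for a b :: 'c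
    by transfer (simp add: single_add gpoly_mod.span_zero)
  have mult: "eps_const (a * b) = eps_const a * eps_const b" for a b :: 'c
    by transfer (simp add: mult_single gpoly_mod.span_zero)
  have one: "eps_const 1 = (1 :: 'c eps_alg)"
    by transfer (simp add: gpoly_mod.span_zero)
  show "eps_scale a (x + y) = eps_scale a x + eps_scale a y" for a :: 'c and x y
    by (simp add: eps_scale_def algebra_simps)
  show "eps_scale (a + b) x = eps_scale a x + eps_scale b x" for a b :: 'c and x
    by (simp add: eps_scale_def add algebra_simps)
  show "eps_scale a (eps_scale b x) = eps_scale (a * b) x" for a b :: 'c and x
    by (simp add: eps_scale_def mult algebra_simps)
  show "eps_scale 1 x = x" for x :: "'c eps_alg"
    by (simp add: eps_scale_def one)
qed

lift_definition eps_perm :: "(nat \<Rightarrow> nat) \<Rightarrow> 'c::comm_ring_1 eps_alg \<Rightarrow> 'c eps_alg"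
  is "\<lambda>\<sigma>. gpoly_subst (case_gen Theta (\<lambda>i. Eps (\<sigma> i)))"
  by (simp flip: gpoly_subst_diff add: gpoly_subst_ideal)

lemma eps_perm_theta: "eps_perm \<sigma> theta = theta"
  by transfer (simp add: gpoly_mod.span_zero)

lemma eps_perm_eps: "eps_perm \<sigma> (eps i) = eps (\<sigma> i)"
  by transfer (simp add: gpoly_mod.span_zero)

lemma eps_perm_const: "eps_perm \<sigma> (eps_const c) = eps_const c"
  by transfer (simp add: gpoly_mod.span_zero)

lemma eps_perm_add: "eps_perm \<sigma> (x + y) = eps_perm \<sigma> x + eps_perm \<sigma> y"
  by transfer (simp only: pm_push_add diff_self gpoly_mod.span_zero)

lemma eps_perm_mult: "eps_perm \<sigma> (x * y) = eps_perm \<sigma> x * eps_perm \<sigma> y"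
  by transfer (simp only: gpoly_subst_mult diff_self gpoly_mod.span_zero)

text \<open>
  The sign belonging to a tuple \<open>(e\<^sub>1, \<dots>, e\<^sub>n)\<close> of generators of the generalized Grassmann algebra;
  its factors involve only the corresponding elements \<open>eps\<close>.
\<close>

definition gen_sign :: "nat \<Rightarrow> (nat \<Rightarrow> nat) \<Rightarrow> 'c::comm_ring_1 eps_alg" where
  "gen_sign n \<sigma> = (\<Prod>(i, j) \<in> {(i, j). i < j \<and> j < n \<and> \<sigma> i > \<sigma> j}. 1 - eps (\<sigma> i) * eps (\<sigma> j))"

definition sign_action :: "nat \<Rightarrow> (nat \<Rightarrow> nat) \<Rightarrow> 'c::comm_ring_1 eps_alg \<Rightarrow> 'c eps_alg" where
  "sign_action n \<sigma> x = gen_sign n \<sigma> * eps_perm \<sigma> x"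

definition sign_submodule :: "nat \<Rightarrow> 'c::comm_ring_1 eps_alg set \<Rightarrow> bool" where
  "sign_submodule n M \<longleftrightarrow>
     eps_mod.subspace M \<and> (\<forall>\<sigma>. \<sigma> permutes {..<n} \<longrightarrow> (\<forall>x\<in>M. sign_action n \<sigma> x \<in> M))"

text \<open>The $C[S_n]$-submodule generated by 1.\<close>

definition eps_module :: "nat \<Rightarrow> 'c::comm_ring_1 eps_alg set" where
  "eps_module n = sign_submodule n hull {1}"

end

theory Submission
  imports Defs
begin

text \<open>
  Consider, for every \<open>S \<subseteq> {..<n}\<close>, the element
  $$b_S = \prod_{a\in S}\varepsilon_a\cdot\prod_{a}(1-\theta\varepsilon_a),$$
  where the second product is over the $a\notin S$ below \<open>n\<close> with an odd number of elements of \<open>S\<close>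
  above \<open>a\<close> (\<open>basis_elem\<close>). The elements $b_S$ with \<open>|S|\<close> even form a basis; as \<open>n \<ge> 1\<close>, there are
  $2^{n-1}$ of them.

  The reason is that an adjacent transposition $s = (a\;a{+}1)$ acts on these elements by a simple
  rule: $s\,b_S$ equals $-b_S$ if both \<open>a\<close> and \<open>a + 1\<close> are in \<open>S\<close>, $b_{s(S)}$ if exactly one of
  them is, and $b_S - b_{S\cup\{a,a+1\}}$ if none is (\<open>sign_action_basis_elem_both\<close>,
  \<open>sign_action_basis_elem_one\<close>, \<open>sign_action_basis_elem_none\<close>). The parity of \<open>|S|\<close> is preserved in
  all cases, so the span of the even $b_S$ is stable under the adjacent transpositions. By the
  cocycle property of the generalized sign (\<open>gen_sign_adjacent_comp\<close>) it is then stable under the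
  whole symmetric group, and it contains $b_\emptyset = 1$. Conversely the same rule builds every
  even $b_S$ from 1, by creating adjacent pairs and moving single elements
  (\<open>basis_elem_in_submodule\<close>).

  For independence, $b_S$ is $\prod_{a\in S}\varepsilon_a$ plus terms that involve a further
  $\varepsilon_a$. The coefficient functionals below detect this leading term, and the resulting
  system is unitriangular (\<open>independent_basis_elem\<close>).
\<close>

section \<open>Coefficient functionals\<close>

definition monomial_degree :: "(gen \<Rightarrow>\<^sub>0 nat) \<Rightarrow> nat" where
  "monomial_degree m = (\<Sum>x\<in>Poly_Mapping.keys m. Poly_Mapping.lookup m x)"

definition eps_support :: "(gen \<Rightarrow>\<^sub>0 nat) \<Rightarrow> nat set" where
  "eps_support m = {i. Poly_Mapping.lookup m (Eps i) \<noteq> 0}"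

text \<open>
  Modulo the relations a monomial of degree $d$ with support \<open>T\<close> equals
  $\theta^{d-|T|}\prod_{i\in T}\varepsilon_i$. The weight is the coefficient of
  $\prod_{i\in T}\varepsilon_i$ in the free $C$-basis consisting of the products
  $\prod_{i\in T}\varepsilon_i$ and $\theta\prod_{i\in T}\varepsilon_i$; an odd power of $\theta$
  contributes only to the latter.
\<close>

definition coeff_weight :: "nat set \<Rightarrow> (gen \<Rightarrow>\<^sub>0 nat) \<Rightarrow> 'c::comm_ring_1" where
  "coeff_weight T m = (if eps_support m = T \<and> even (monomial_degree m - card T)
     then 2 ^ ((monomial_degree m - card T) div 2) else 0)"

definition gpoly_coeff :: "nat set \<Rightarrow> 'c::comm_ring_1 gpoly \<Rightarrow> 'c" where
  "gpoly_coeff T p = (\<Sum>m\<in>Poly_Mapping.keys p. coeff_weight T m * Poly_Mapping.lookup p m)"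

lemma monomial_degree_add: "monomial_degree (m + m') = monomial_degree m + monomial_degree m'"
  unfolding monomial_degree_def by (rule sum_keys_add) simp_all

lemma monomial_degree_single [simp]: "monomial_degree (Poly_Mapping.single x k) = k"
  by (simp add: monomial_degree_def)

lemma eps_support_add: "eps_support (m + m') = eps_support m \<union> eps_support m'"
  by (auto simp: eps_support_def lookup_add)

lemma eps_support_Theta [simp]: "eps_support (Poly_Mapping.single Theta k) = {}"
  by (simp add: eps_support_def lookup_single)

lemma eps_support_Eps [simp]: "eps_support (Poly_Mapping.single (Eps i) (Suc k)) = {i}"
  by (auto simp: eps_support_def lookup_single when_def)

text \<open>This keeps the subtraction in \<open>coeff_weight\<close> from being truncated.\<close>

lemma card_eps_support_le: "card (eps_support m) \<le> monomial_degree m"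
proof -
  have sub: "Eps ` eps_support m \<subseteq> Poly_Mapping.keys m"
    by (auto simp: eps_support_def in_keys_iff)
  have "card (eps_support m) = card (Eps ` eps_support m)"
    by (simp add: card_image inj_on_def)
  also have "\<dots> \<le> card (Poly_Mapping.keys m)"
    using sub by (intro card_mono) simp_all
  also have "\<dots> = (\<Sum>x\<in>Poly_Mapping.keys m. 1)"
    by simp
  also have "\<dots> \<le> monomial_degree m"
    unfolding monomial_degree_def
    by (intro sum_mono) (simp add: in_keys_iff Suc_le_eq)
  finally show ?thesis .
qed

lemma gpoly_coeff_zero [simp]: "gpoly_coeff T 0 = 0"
  by (simp add: gpoly_coeff_def)

lemma gpoly_coeff_add: "gpoly_coeff T (p + q) = gpoly_coeff T p + gpoly_coeff T q"
  unfolding gpoly_coeff_def by (rule sum_keys_add) (simp_all add: algebra_simps)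

lemma gpoly_coeff_diff: "gpoly_coeff T (p - q) = gpoly_coeff T p - gpoly_coeff T q"
  using gpoly_coeff_add[of T "p - q" q] by simp

lemma gpoly_coeff_single [simp]:
  "gpoly_coeff T (Poly_Mapping.single m c) = coeff_weight T m * c"
  by (simp add: gpoly_coeff_def)

lemma gpoly_coeff_mult_relation:
  assumes "r \<in> eps_relations"
  shows "gpoly_coeff T (p * r) = 0"
proof (induction p rule: poly_mapping_add_induct)
  case (single m c)
  have two: "(2 :: 'a gpoly) = Poly_Mapping.single 0 2"
    unfolding one_add_one[symmetric] single_add single_one ..
  consider "r = Var Theta ^ 2 - 2" | i where "r = Var (Eps i) ^ 2 - Var Theta * Var (Eps i)"
    using assms unfolding eps_relations_def by auto
  then show ?case
  proof cases
    case 1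
    have "coeff_weight T
        (m + (Poly_Mapping.single Theta (Suc 0) + Poly_Mapping.single Theta (Suc 0)))
      = (2 * coeff_weight T m :: 'a)"
    proof (cases "eps_support m = T")
      case True
      then obtain d where "monomial_degree m = card T + d"
        using card_eps_support_le[of m] le_Suc_ex by blast
      then show ?thesis
        by (simp add: coeff_weight_def monomial_degree_add eps_support_add)
    qed (simp add: coeff_weight_def eps_support_add)
    then show ?thesis
      unfolding 1 two
      by (simp add: right_diff_distrib mult_ac gpoly_coeff_diff Var_def mult_single power2_eq_square
          del: single_numeral)
  next
    case (2 i)
    show ?thesis
      unfolding 2
      by (auto simp: right_diff_distrib gpoly_coeff_diff Var_def mult_single power2_eq_square
          coeff_weight_def monomial_degree_add eps_support_add)
  qed
qed (simp_all add: gpoly_coeff_add distrib_right)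

lemma gpoly_coeff_ideal: "p \<in> eps_ideal \<Longrightarrow> gpoly_coeff T p = 0"
  by (induction p rule: gpoly_mod.span_induct_alt)
    (simp_all add: gpoly_coeff_add gpoly_coeff_mult_relation)

lift_definition eps_coeff :: "nat set \<Rightarrow> 'c::comm_ring_1 eps_alg \<Rightarrow> 'c" is gpoly_coeff
  using gpoly_coeff_ideal by (fastforce simp: gpoly_coeff_diff)

lemma eps_coeff_zero [simp]: "eps_coeff T 0 = 0"
  by transfer simp

lemma eps_coeff_add: "eps_coeff T (x + y) = eps_coeff T x + eps_coeff T y"
  by transfer (rule gpoly_coeff_add)

lemma eps_coeff_diff: "eps_coeff T (x - y) = eps_coeff T x - eps_coeff T y"
  by transfer (rule gpoly_coeff_diff)

lemma eps_coeff_scale: "eps_coeff T (eps_scale c x) = c * eps_coeff T x"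
  unfolding eps_scale_def
proof transfer
  fix T c and p :: "'a gpoly"
  show "gpoly_coeff T (Poly_Mapping.single 0 c * p) = c * gpoly_coeff T p"
    by (induction p rule: poly_mapping_add_induct)
      (simp_all add: mult_single gpoly_coeff_add distrib_left mult.left_commute)
qed

lemma eps_coeff_sum: "eps_coeff T (\<Sum>i\<in>A. f i) = (\<Sum>i\<in>A. eps_coeff T (f i))"
  by (induction A rule: infinite_finite_induct) (simp_all add: eps_coeff_add)

lemma eps_coeff_eps_mult:
  assumes "i \<notin> T"
  shows "eps_coeff T (eps i * x) = 0"
  using assms
proof transfer
  fix i :: nat and T and p :: "'a gpoly"
  assume "i \<notin> T"
  then show "gpoly_coeff T (Var (Eps i) * p) = 0"
    by (induction p rule: poly_mapping_add_induct)
      (auto simp: Var_def mult_single gpoly_coeff_add distrib_left coeff_weight_def eps_support_add)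
qed

lemma eps_coeff_prod_eps:
  assumes "finite T"
  shows "eps_coeff T (\<Prod>i\<in>T. eps i :: 'c::comm_ring_1 eps_alg) = 1"
proof -
  define mon where "mon A = (\<Sum>i\<in>A. Poly_Mapping.single (Eps i) (1::nat))" for A
  have "(\<Prod>i\<in>A. eps i) = abs_eps_alg (Poly_Mapping.single (mon A) (1::'c))
      \<and> eps_support (mon A) = A \<and> monomial_degree (mon A) = card A" if "finite A" for A
    using that
  proof induction
    case empty
    show ?case
      by (simp add: mon_def one_eps_alg_def eps_support_def monomial_degree_def)
  next
    case (insert i A)
    have "mon (insert i A) = Poly_Mapping.single (Eps i) 1 + mon A"
      using insert by (simp add: mon_def)
    then show ?case
      using insert
      by (simp add: eps_def times_eps_alg.abs_eq Var_def mult_single eps_support_add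
          monomial_degree_add)
  qed
  from this[OF assms] show ?thesis
    by (simp add: eps_coeff.abs_eq coeff_weight_def)
qed

section \<open>The sign action of adjacent transpositions\<close>

lemma eps_perm_one [simp]: "eps_perm \<sigma> 1 = 1"
  by transfer (simp add: gpoly_mod.span_zero)

lemma eps_perm_zero: "eps_perm \<sigma> 0 = 0"
  using eps_perm_add[of \<sigma> 0 0] by simp

lemma eps_perm_diff: "eps_perm \<sigma> (x - y) = eps_perm \<sigma> x - eps_perm \<sigma> y"
  using eps_perm_add[of \<sigma> "x - y" y] by simp

lemma eps_perm_prod: "eps_perm \<sigma> (\<Prod>i\<in>A. f i) = (\<Prod>i\<in>A. eps_perm \<sigma> (f i))"
  by (induction A rule: infinite_finite_induct) (simp_all add: eps_perm_mult)

lemma pm_push_comp: "pm_push f (pm_push g p) = pm_push (f \<circ> g) p"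
  by (induction p rule: poly_mapping_add_induct) (simp_all add: pm_push_add)

lemma pm_push_ident: "pm_push (\<lambda>x. x) = (\<lambda>p. p)"
proof
  show "pm_push (\<lambda>x. x) p = p" for p :: "'a \<Rightarrow>\<^sub>0 'b::comm_monoid_add"
    by (induction p rule: poly_mapping_add_induct) (simp_all add: pm_push_add)
qed

lemma eps_perm_comp: "eps_perm (\<sigma> \<circ> \<tau>) x = eps_perm \<sigma> (eps_perm \<tau> x)"
proof transfer
  fix \<sigma> \<tau> :: "nat \<Rightarrow> nat" and p :: "'a gpoly"
  let ?g = "\<lambda>\<sigma>. case_gen Theta (\<lambda>i. Eps (\<sigma> i))"
  have "?g (\<sigma> \<circ> \<tau>) = ?g \<sigma> \<circ> ?g \<tau>"
    by (auto simp: fun_eq_iff split: gen.split)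
  then have "gpoly_subst (?g (\<sigma> \<circ> \<tau>)) p = gpoly_subst (?g \<sigma>) (gpoly_subst (?g \<tau>) p)"
    by (simp add: pm_push_comp comp_def)
  then show "gpoly_subst (?g (\<sigma> \<circ> \<tau>)) p - gpoly_subst (?g \<sigma>) (gpoly_subst (?g \<tau>) p) \<in> eps_ideal"
    by (simp add: gpoly_mod.span_zero)
qed

lemma eps_perm_id: "eps_perm id x = x"
proof transfer
  fix p :: "'a gpoly"
  have ident: "case_gen Theta (\<lambda>i. Eps (id i)) = (\<lambda>x. x)"
    by (auto simp: fun_eq_iff split: gen.split)
  show "gpoly_subst (case_gen Theta (\<lambda>i. Eps (id i))) p - p \<in> eps_ideal"
    unfolding ident pm_push_ident by (simp add: gpoly_mod.span_zero)
qed

lemma theta_theta: "theta * (theta * x) = 2 * (x :: 'c::comm_ring_1 eps_alg)"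
  using theta_square[where ?'c='c] by (simp add: power2_eq_square flip: mult.assoc)

lemma eps_eps: "eps i * eps i = (theta * eps i :: 'c::comm_ring_1 eps_alg)"
  using eps_square[of i, where ?'c='c] by (simp add: power2_eq_square)

lemma eps_eps_mult: "eps i * (eps i * x) = theta * (eps i * (x :: 'c::comm_ring_1 eps_alg))"
  using eps_eps[of i, where ?'c='c] by (simp flip: mult.assoc)

lemma sign_factor_square: "(1 - eps i * eps j) * (1 - eps i * eps j) = (1 :: 'c::comm_ring_1 eps_alg)"
  by (simp add: algebra_simps eps_eps_mult eps_eps theta_theta)

text \<open>
  Taking the product over all pairs, with trivial factors at the non-inversions, allows the signs of
  two permutations to be compared factor by factor.
\<close>

lemma gen_sign_conv:
  "gen_sign n \<sigma> = (\<Prod>(i, j) \<in> {(i, j). i < j \<and> j < n}.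
     if \<sigma> i > \<sigma> j then 1 - eps (\<sigma> i) * eps (\<sigma> j) else 1)"
proof -
  have "finite {(i, j). i < j \<and> j < n}"
    by (rule finite_subset[of _ "{..<n} \<times> {..<n}"]) auto
  then show ?thesis
    unfolding gen_sign_def by (intro prod.mono_neutral_cong_left) (auto split: if_splits)
qed

text \<open>
  This is the cocycle identity $\mathfrak{sgn}(s\tau) = \mathfrak{sgn}(s)\,\phi_s(\mathfrak{sgn}(\tau))$
  for an adjacent transposition \<open>s\<close>. Exchanging the values \<open>a\<close> and \<open>a + 1\<close> toggles the inversion at the
  pair of positions where \<open>\<tau>\<close> takes them and no other inversion. Toggling amounts to multiplication by
  $1-\varepsilon_a\varepsilon_{a+1}$ in both directions, since this element is its own inverse.
\<close>

lemma gen_sign_adjacent_comp: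
  assumes \<tau>: "\<tau> permutes {..<n}" and a: "Suc a < n"
  shows "gen_sign n (transpose a (Suc a) \<circ> \<tau>)
    = (1 - eps a * eps (Suc a)) * eps_perm (transpose a (Suc a)) (gen_sign n \<tau>)"
proof -
  let ?s = "transpose a (Suc a)"
  let ?P = "{(i, j). i < j \<and> j < n}"
  let ?f = "\<lambda>\<sigma> (i, j). if \<sigma> i > \<sigma> j then 1 - eps (\<sigma> i) * eps (\<sigma> j) else (1 :: 'a eps_alg)"
  have fin: "finite ?P"
    by (rule finite_subset[of _ "{..<n} \<times> {..<n}"]) auto
  obtain p q where p: "\<tau> p = a" and q: "\<tau> q = Suc a"
    using permutes_surj[OF \<tau>] by (metis surjD)
  have "p < n" "q < n"
    using permutes_in_image[OF \<tau>, of p] permutes_in_image[OF \<tau>, of q] p q a by simp_all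
  moreover have "p \<noteq> q"
    using p q by auto
  ultimately have pq: "(min p q, max p q) \<in> ?P"
    by auto
  have inj: "\<tau> i = \<tau> j \<longleftrightarrow> i = j" for i j
    using permutes_inj[OF \<tau>] by (simp add: inj_eq)
  have rest: "?f (?s \<circ> \<tau>) ij = eps_perm ?s (?f \<tau> ij)" if mem: "ij \<in> ?P - {(min p q, max p q)}" for ij
  proof -
    obtain i j where ij: "ij = (i, j)" "i < j"
      using mem by auto
    have "\<not> (i = p \<and> j = q)" "\<not> (i = q \<and> j = p)"
      using mem ij by auto
    then have "\<not> (\<tau> i = a \<and> \<tau> j = Suc a)" "\<not> (\<tau> i = Suc a \<and> \<tau> j = a)"
      using inj p q by metis+
    moreover have "\<tau> i \<noteq> \<tau> j"
      using ij inj by simp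
    ultimately have "?s (\<tau> i) > ?s (\<tau> j) \<longleftrightarrow> \<tau> i > \<tau> j"
      by (auto simp: transpose_def)
    then show ?thesis
      by (simp add: ij eps_perm_diff eps_perm_mult eps_perm_eps)
  qed
  \<comment> \<open>If \<open>p < q\<close>, the factor is created; otherwise its square 1 appears on the right.\<close>
  have special: "?f (?s \<circ> \<tau>) (min p q, max p q)
      = (1 - eps a * eps (Suc a)) * eps_perm ?s (?f \<tau> (min p q, max p q))"
    using p q \<open>p \<noteq> q\<close> sign_factor_square[of a "Suc a", where ?'c='a]
    by (cases "p < q")
      (simp_all add: min_def max_def eps_perm_diff eps_perm_mult eps_perm_eps mult.commute)
  have rest_prod: "prod (?f (?s \<circ> \<tau>)) (?P - {(min p q, max p q)})
      = (\<Prod>ij\<in>?P - {(min p q, max p q)}. eps_perm ?s (?f \<tau> ij))"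
    by (intro prod.cong refl rest)
  show ?thesis
    unfolding gen_sign_conv prod.remove[OF fin pq] eps_perm_mult eps_perm_prod special rest_prod
    by (rule mult.assoc)
qed

lemma gen_sign_id [simp]: "gen_sign n id = 1"
  unfolding gen_sign_def by (rule prod.neutral) auto

lemma sign_action_id: "sign_action n id x = x"
  by (simp add: sign_action_def eps_perm_id)

lemma sign_action_adjacent:
  fixes x :: "'c::comm_ring_1 eps_alg"
  assumes "Suc a < n"
  shows "sign_action n (transpose a (Suc a)) x
    = (1 - eps a * eps (Suc a)) * eps_perm (transpose a (Suc a)) x"
  using gen_sign_adjacent_comp[of id n a, where ?'a='c] assms
  by (simp add: sign_action_def permutes_id)

lemma sign_action_adjacent_comp:
  assumes "\<tau> permutes {..<n}" "Suc a < n"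
  shows "sign_action n (transpose a (Suc a) \<circ> \<tau>) x
    = sign_action n (transpose a (Suc a)) (sign_action n \<tau> x)"
  using assms
  by (simp add: sign_action_adjacent) (simp add: sign_action_def gen_sign_adjacent_comp eps_perm_comp
      eps_perm_mult mult.assoc)

lemma sign_action_add: "sign_action n \<sigma> (x + y) = sign_action n \<sigma> x + sign_action n \<sigma> y"
  by (simp add: sign_action_def eps_perm_add distrib_left)

lemma sign_action_scale: "sign_action n \<sigma> (eps_scale c x) = eps_scale c (sign_action n \<sigma> x)"
  by (simp add: sign_action_def eps_scale_def eps_perm_mult eps_perm_const mult_ac)

text \<open>
  Adjacent transpositions generate the symmetric group. The induction predicate is strengthened to
  \<open>Q\<close>, which holds for a permutation if composing with it on the left preserves \<open>P\<close>; \<open>Q\<close> is closed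
  under composition and therefore holds for all transpositions, being conjugates of adjacent ones.
\<close>

lemma permutes_adjacent_induct [consumes 1, case_names id adjacent]:
  assumes \<sigma>: "\<sigma> permutes {..<n}" and id: "P id"
    and adj: "\<And>\<tau> a. \<tau> permutes {..<n} \<Longrightarrow> Suc a < n \<Longrightarrow> P \<tau> \<Longrightarrow> P (transpose a (Suc a) \<circ> \<tau>)"
  shows "P \<sigma>"
proof -
  define Q where "Q \<rho> \<longleftrightarrow> \<rho> permutes {..<n} \<and>
    (\<forall>\<tau>. \<tau> permutes {..<n} \<longrightarrow> P \<tau> \<longrightarrow> P (\<rho> \<circ> \<tau>))" for \<rho>
  have comp: "Q (\<rho> \<circ> \<rho>')" if "Q \<rho>" "Q \<rho>'" for \<rho> \<rho>'
    using that unfolding Q_def by (auto intro: permutes_compose simp: comp_assoc)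
  have step: "Q (transpose a (Suc a))" if "Suc a < n" for a
    using that adj unfolding Q_def by (auto intro: permutes_swap_id)
  have shift: "transpose a (Suc (Suc b))
      = transpose (Suc b) (Suc (Suc b)) \<circ> (transpose a (Suc b) \<circ> transpose (Suc b) (Suc (Suc b)))"
    if "a < Suc b" for a b :: nat
    using that by (auto simp: fun_eq_iff transpose_def)
  have less: "Q (transpose a b)" if "a < b" "b < n" for a b
    using that
  proof (induction b)
    case (Suc b)
    show ?case
    proof (cases "a = b")
      case True
      then show ?thesis using step Suc.prems by simp
    next
      case False
      with Suc.prems obtain c where "b = Suc c" "a < Suc c"
        by (cases b) auto
      then show ?thesis
        using Suc step[of b] comp unfolding \<open>b = Suc c\<close> by (subst shift) simp_all
    qed
  qed simp
  have transposition: "Q (transpose a b)" if "a < n" "b < n" "a \<noteq> b" for a b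
    using that less[of a b] less[of b a] by (cases "a < b") (auto simp: transpose_commute)
  have "Q \<sigma>"
    using \<sigma> finite_lessThan
  proof (induction rule: permutes_induct)
    case id
    show ?case by (simp add: Q_def permutes_id flip: id_def)
  next
    case (swap a b p)
    then show ?case by (intro comp transposition) simp_all
  qed
  then have "P (\<sigma> \<circ> id)"
    using id permutes_id unfolding Q_def by blast
  then show ?thesis by simp
qed

section \<open>Basis elements and their images under adjacent transpositions\<close>

text \<open>
  \<open>basis_elem n S\<close> is the image of $\prod_{i<|S|}\varepsilon_i$ under the sign action of the
  permutation that carries the first $|S|$ indices onto \<open>S\<close> and the others onto the complement, both
  in increasing order. A value outside \<open>S\<close> is then inverted with the elements of \<open>S\<close> above it only, each of these
  inversions contributes the factor $1-\theta\varepsilon_a$, because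
  $\varepsilon_b(1-\varepsilon_a\varepsilon_b) = \varepsilon_b(1-\theta\varepsilon_a)$, and only
  their parity matters, because $(1-\theta\varepsilon_a)^2 = 1$. Giving the factors directly makes
  the action of adjacent transpositions a computation in two variables.
\<close>

definition basis_factor :: "nat set \<Rightarrow> nat \<Rightarrow> 'c::comm_ring_1 eps_alg" where
  "basis_factor S a = (if a \<in> S then eps a
     else if odd (card {b\<in>S. a < b}) then 1 - theta * eps a else 1)"

definition basis_elem :: "nat \<Rightarrow> nat set \<Rightarrow> 'c::comm_ring_1 eps_alg" where
  "basis_elem n S = (\<Prod>a<n. basis_factor S a)"

lemma basis_elem_empty [simp]: "basis_elem n {} = 1"
  by (simp add: basis_elem_def basis_factor_def)

lemma basis_elem_adjacent:
  assumes "Suc a < n"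
  shows "basis_elem n S = basis_factor S a * basis_factor S (Suc a)
    * (\<Prod>x\<in>{..<n} - {a, Suc a}. basis_factor S x)"
  using assms prod.subset_diff[of "{a, Suc a}" "{..<n}" "basis_factor S"]
  by (simp add: basis_elem_def mult_ac)

lemma eps_perm_basis_factor:
  "eps_perm \<sigma> (basis_factor S a) = (if a \<in> S then eps (\<sigma> a)
     else if odd (card {b\<in>S. a < b}) then 1 - theta * eps (\<sigma> a) else 1)"
  by (simp add: basis_factor_def eps_perm_eps eps_perm_diff eps_perm_mult eps_perm_theta)

text \<open>The transposition of \<open>a\<close> and \<open>a + 1\<close> can move an element across \<open>x\<close> only if \<open>x = a\<close>.\<close>

lemma card_above_adjacent_image:
  assumes "x \<noteq> a"
  shows "card {b \<in> transpose a (Suc a) ` S. x < b} = card {b\<in>S. x < b}"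
proof -
  let ?s = "transpose a (Suc a)"
  have "x < ?s b \<longleftrightarrow> x < b" for b
    using assms by (auto simp: transpose_def)
  then have "{b \<in> ?s ` S. x < b} = ?s ` {b\<in>S. x < b}"
    by auto
  then show ?thesis
    by (simp add: card_image inj_on_transpose)
qed

lemma card_above_Suc:
  assumes "finite S"
  shows "card {b\<in>S. a < b} = card {b\<in>S. Suc a < b} + of_bool (Suc a \<in> S)"
proof -
  have "{b\<in>S. a < b} = {b\<in>S. Suc a < b} \<union> (if Suc a \<in> S then {Suc a} else {})"
    by (auto simp: less_Suc_eq) (metis Suc_lessI)
  then show ?thesis
    using assms by (simp add: card_insert_if)
qed

lemma basis_factor_adjacent_image:
  assumes "x \<notin> {a, Suc a}"
  shows "basis_factor (transpose a (Suc a) ` S) x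
    = eps_perm (transpose a (Suc a)) (basis_factor S x)"
proof -
  let ?s = "transpose a (Suc a)"
  have fixed: "?s x = x"
    using assms by simp
  then have "x \<in> ?s ` S \<longleftrightarrow> x \<in> S"
    by (simp add: in_transpose_image_iff)
  with fixed show ?thesis
    using assms unfolding eps_perm_basis_factor
    by (simp add: card_above_adjacent_image) (simp add: basis_factor_def card_above_adjacent_image)
qed

text \<open>
  In the next three lemmas the factors at indices other than \<open>a\<close> and \<open>a + 1\<close> are carried along
  unchanged, so each of them is an identity between the two remaining factors. Here it is
  $(1-\varepsilon_a\varepsilon_{a+1})\varepsilon_{a+1}
    = \varepsilon_{a+1}(1-\theta\varepsilon_a)$, or the same with the indices exchanged: the new
  factor accounts for the change in parity when an element of \<open>S\<close> passes the other index.
\<close>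

lemma sign_action_basis_elem_one:
  assumes S: "finite S" and a: "Suc a < n" and one: "(a \<in> S) \<noteq> (Suc a \<in> S)"
  shows "sign_action n (transpose a (Suc a)) (basis_elem n S)
    = (basis_elem n (transpose a (Suc a) ` S) :: 'c::comm_ring_1 eps_alg)"
proof -
  let ?s = "transpose a (Suc a)"
  define R where "R = (\<Prod>x\<in>{..<n} - {a, Suc a}. basis_factor (?s ` S) x :: 'c eps_alg)"
  have mem: "a \<in> ?s ` S \<longleftrightarrow> Suc a \<in> S" "Suc a \<in> ?s ` S \<longleftrightarrow> a \<in> S"
    by (simp_all add: in_transpose_image_iff)
  have R: "eps_perm ?s (\<Prod>x\<in>{..<n} - {a, Suc a}. basis_factor S x) = R"
    unfolding R_def eps_perm_prod
    by (intro prod.cong refl) (simp add: basis_factor_adjacent_image)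
  have "(1 - eps a * eps (Suc a))
        * (eps_perm ?s (basis_factor S a) * eps_perm ?s (basis_factor S (Suc a)))
      = (basis_factor (?s ` S) a * basis_factor (?s ` S) (Suc a) :: 'c eps_alg)"
    using one S unfolding eps_perm_basis_factor
    by (auto simp: basis_factor_def mem card_above_Suc[of S a] card_above_Suc[of "?s ` S" a]
          card_above_adjacent_image algebra_simps eps_eps eps_eps_mult theta_theta)
  then show ?thesis
    unfolding sign_action_adjacent[OF a] basis_elem_adjacent[OF a] eps_perm_mult R
    by (simp add: R_def flip: mult.assoc)
qed

text \<open>
  $(\varepsilon_a\varepsilon_{a+1})^2 = \theta^2\varepsilon_a\varepsilon_{a+1}
    = 2\varepsilon_a\varepsilon_{a+1}$.
\<close>

lemma sign_action_basis_elem_both: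
  assumes a: "Suc a < n" and both: "a \<in> S" "Suc a \<in> S"
  shows "sign_action n (transpose a (Suc a)) (basis_elem n S)
    = - (basis_elem n S :: 'c::comm_ring_1 eps_alg)"
proof -
  let ?s = "transpose a (Suc a)"
  have "?s ` S = S"
    using both by simp
  then have R: "eps_perm ?s (\<Prod>x\<in>{..<n} - {a, Suc a}. basis_factor S x)
      = (\<Prod>x\<in>{..<n} - {a, Suc a}. basis_factor S x :: 'c eps_alg)"
    unfolding eps_perm_prod
    by (intro prod.cong refl) (metis DiffD2 basis_factor_adjacent_image)
  have "(1 - eps a * eps (Suc a))
        * (eps_perm ?s (basis_factor S a) * eps_perm ?s (basis_factor S (Suc a)))
      = - (basis_factor S a * basis_factor S (Suc a) :: 'c eps_alg)"
    using both unfolding eps_perm_basis_factor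
    by (simp add: basis_factor_def algebra_simps eps_eps eps_eps_mult theta_theta)
  then show ?thesis
    unfolding sign_action_adjacent[OF a] basis_elem_adjacent[OF a] eps_perm_mult R
    by (simp flip: mult.assoc)
qed

text \<open>
  Adding two adjacent elements to \<open>S\<close> changes no parity at the other indices. If the parity at
  \<open>a\<close> and \<open>a + 1\<close> is odd, the factors $1-\theta\varepsilon_a$ and $1-\theta\varepsilon_{a+1}$
  are absorbed by $\varepsilon_a\varepsilon_{a+1}$ up to two signs that cancel, since
  $\varepsilon_a(1-\theta\varepsilon_a) = -\varepsilon_a$.
\<close>

lemma sign_action_basis_elem_none:
  assumes S: "finite S" and a: "Suc a < n" and none: "a \<notin> S" "Suc a \<notin> S"
  shows "sign_action n (transpose a (Suc a)) (basis_elem n S)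
    = basis_elem n S - (basis_elem n (insert a (insert (Suc a) S)) :: 'c::comm_ring_1 eps_alg)"
proof -
  let ?s = "transpose a (Suc a)"
  let ?S = "insert a (insert (Suc a) S)"
  define R where "R = (\<Prod>x\<in>{..<n} - {a, Suc a}. basis_factor S x :: 'c eps_alg)"
  have "?s ` S = S"
    using none by simp
  then have R: "eps_perm ?s R = R"
    unfolding R_def eps_perm_prod
    by (intro prod.cong refl) (metis DiffD2 basis_factor_adjacent_image)
  have R': "(\<Prod>x\<in>{..<n} - {a, Suc a}. basis_factor ?S x) = R"
    unfolding R_def
  proof (rule prod.cong)
    fix x assume x: "x \<in> {..<n} - {a, Suc a}"
    have "{b\<in>?S. x < b} = (if x < a then insert a (insert (Suc a) {b\<in>S. x < b}) else {b\<in>S. x < b})"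
      using x by auto
    then have "card {b\<in>?S. x < b} = (if x < a then 2 else 0) + card {b\<in>S. x < b}"
      using none S by simp
    then show "basis_factor ?S x = (basis_factor S x :: 'c eps_alg)"
      using x by (simp add: basis_factor_def)
  qed simp
  have "(1 - eps a * eps (Suc a))
        * (eps_perm ?s (basis_factor S a) * eps_perm ?s (basis_factor S (Suc a)))
      = basis_factor S a * basis_factor S (Suc a)
        - (basis_factor ?S a * basis_factor ?S (Suc a) :: 'c eps_alg)"
    using none S unfolding eps_perm_basis_factor
    by (simp add: basis_factor_def card_above_Suc[of S a] algebra_simps eps_eps
        eps_eps_mult theta_theta)
  then show ?thesis
    unfolding sign_action_adjacent[OF a] basis_elem_adjacent[OF a] eps_perm_mult R'
      R_def[symmetric] R
    by (simp add: left_diff_distrib flip: mult.assoc)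
qed

section \<open>Linear independence\<close>

lemma eps_coeff_basis_elem_eq_0:
  assumes "S \<subseteq> {..<n}" "\<not> S \<subseteq> T"
  shows "eps_coeff T (basis_elem n S :: 'c::comm_ring_1 eps_alg) = 0"
proof -
  obtain i where i: "i \<in> S" "i \<notin> T" "i < n"
    using assms by blast
  have "basis_elem n S = eps i * (\<Prod>a\<in>{..<n} - {i}. basis_factor S a :: 'c eps_alg)"
    using i unfolding basis_elem_def by (subst prod.remove[of _ i]) (simp_all add: basis_factor_def)
  with i show ?thesis
    by (simp add: eps_coeff_eps_mult)
qed

text \<open>
  Each further factor $1-\theta\varepsilon_a$ with $a\notin S$ changes the product only by a multiple
  of $\varepsilon_a$, which the functional does not see.
\<close>

lemma eps_coeff_basis_elem_self:
  assumes "S \<subseteq> {..<n}"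
  shows "eps_coeff S (basis_elem n S :: 'c::comm_ring_1 eps_alg) = 1"
proof -
  have S: "finite S"
    using assms finite_subset by blast
  have "eps_coeff S ((\<Prod>i\<in>S. eps i) * (\<Prod>a\<in>A. basis_factor S a)) = (1 :: 'c)"
    if "finite A" "A \<inter> S = {}" for A
    using that
  proof (induction A)
    case empty
    then show ?case using S by (simp add: eps_coeff_prod_eps)
  next
    case (insert a A)
    let ?x = "(\<Prod>i\<in>S. eps i) * (\<Prod>a\<in>A. basis_factor S a) :: 'c eps_alg"
    have "?x * (1 - theta * eps a) = ?x - eps a * (theta * ?x)"
      by (simp add: algebra_simps)
    then have "eps_coeff S (?x * basis_factor S a) = eps_coeff S ?x"
      using insert by (simp add: basis_factor_def eps_coeff_diff eps_coeff_eps_mult)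
    moreover have "(\<Prod>i\<in>S. eps i) * (\<Prod>a\<in>insert a A. basis_factor S a) = ?x * basis_factor S a"
      using insert by (simp add: mult_ac)
    moreover have "eps_coeff S ?x = 1"
      using insert by simp
    ultimately show ?case
      by simp
  qed
  then have "eps_coeff S ((\<Prod>i\<in>S. eps i) * (\<Prod>a\<in>{..<n} - S. basis_factor S a)) = (1 :: 'c)"
    by (metis Diff_disjoint finite_Diff finite_lessThan inf_commute)
  moreover have "(\<Prod>i\<in>S. basis_factor S i) = (\<Prod>i\<in>S. eps i :: 'c eps_alg)"
    by (simp add: basis_factor_def)
  ultimately show ?thesis
    using prod.subset_diff[OF assms, of "basis_factor S :: nat \<Rightarrow> 'c eps_alg"]
    by (simp add: basis_elem_def mult.commute)
qed

lemma inj_on_basis_elem: "inj_on (basis_elem n :: _ \<Rightarrow> 'c::comm_ring_1 eps_alg) (Pow {..<n})"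
proof (rule inj_onI)
  fix S T :: "nat set"
  assume *: "S \<in> Pow {..<n}" "T \<in> Pow {..<n}"
    "basis_elem n S = (basis_elem n T :: 'c eps_alg)"
  show "S = T"
    using * eps_coeff_basis_elem_self[of S n, where ?'c='c]
      eps_coeff_basis_elem_self[of T n, where ?'c='c]
      eps_coeff_basis_elem_eq_0[of S n T, where ?'c='c]
      eps_coeff_basis_elem_eq_0[of T n S, where ?'c='c]
    by fastforce
qed

text \<open>
  The matrix of the functionals \<open>eps_coeff T\<close> on the elements \<open>basis_elem n S\<close> is unitriangular for
  inclusion, hence invertible over every commutative ring.
\<close>

lemma independent_basis_elem:
  assumes "\<S> \<subseteq> Pow {..<n}"
  shows "eps_mod.independent (basis_elem n ` \<S> :: 'c::comm_ring_1 eps_alg set)"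
proof -
  have fin: "finite \<S>"
    using assms finite_subset by blast
  have inj: "inj_on (basis_elem n :: _ \<Rightarrow> 'c eps_alg) \<S>"
    using inj_on_basis_elem assms by (rule inj_on_subset)
  have "u (basis_elem n S) = 0"
    if u: "(\<Sum>v\<in>basis_elem n ` \<S>. eps_scale (u v) v) = 0" and "S \<in> \<S>"
    for u :: "'c eps_alg \<Rightarrow> 'c" and S
    using \<open>S \<in> \<S>\<close>
  proof (induction "card S" arbitrary: S rule: less_induct)
    case less
    have S: "S \<subseteq> {..<n}" "finite S"
      using less.prems assms finite_subset by blast+
    have others: "u (basis_elem n T) * eps_coeff S (basis_elem n T) = 0" if T: "T \<in> \<S> - {S}" for T
    proof (cases "T \<subseteq> S")
      case True
      then have "card T < card S"
        using T S by (intro psubset_card_mono) auto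
      then show ?thesis using less.hyps T by simp
    next
      case False
      moreover have "T \<subseteq> {..<n}"
        using T assms by blast
      ultimately show ?thesis by (simp add: eps_coeff_basis_elem_eq_0)
    qed
    have "0 = eps_coeff S (\<Sum>T\<in>\<S>. eps_scale (u (basis_elem n T)) (basis_elem n T))"
      using u by (simp add: sum.reindex[OF inj])
    also have "\<dots> = (\<Sum>T\<in>\<S>. u (basis_elem n T) * eps_coeff S (basis_elem n T))"
      by (simp add: eps_coeff_sum eps_coeff_scale)
    also have "\<dots> = u (basis_elem n S)"
      using fin less.prems others S by (simp add: sum.remove eps_coeff_basis_elem_self)
    finally show ?case by simp
  qed
  then show ?thesis
    using fin by (subst eps_mod.dependent_finite) auto
qed

section \<open>The submodule generated by 1\<close>

lemma sign_submodule_span: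
  fixes B :: "'c::comm_ring_1 eps_alg set"
  assumes gens: "\<And>x a. x \<in> B \<Longrightarrow> Suc a < n
      \<Longrightarrow> sign_action n (transpose a (Suc a)) x \<in> eps_mod.span B"
  shows "sign_submodule n (eps_mod.span B)"
  unfolding sign_submodule_def
proof (intro conjI allI impI)
  fix \<sigma> assume "\<sigma> permutes {..<n}"
  then show "\<forall>x\<in>eps_mod.span B. sign_action n \<sigma> x \<in> eps_mod.span B"
  proof (induction rule: permutes_adjacent_induct)
    case id
    then show ?case by (simp add: sign_action_id flip: id_def)
  next
    case (adjacent \<tau> a)
    have "sign_action n (transpose a (Suc a)) x \<in> eps_mod.span B" if "x \<in> eps_mod.span B" for x
      using that
    proof (induction rule: eps_mod.span_induct_alt)
      case base
      have "sign_action n (transpose a (Suc a)) (0 :: 'c eps_alg) = 0"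
        by (simp add: sign_action_def eps_perm_zero)
      then show ?case by (simp add: eps_mod.span_zero)
    next
      case (step c x y)
      then show ?case
        using gens adjacent
        by (simp add: sign_action_add sign_action_scale eps_mod.span_add eps_mod.span_scale)
    qed
    then show ?case
      using adjacent by (simp add: sign_action_adjacent_comp del: o_apply)
  qed
qed simp

text \<open>
  Induction on the sum of the elements of \<open>S\<close>: its maximum either has its predecessor in \<open>S\<close>, and the
  pair can be removed, or can be moved down by one. Evenness excludes \<open>S = {0}\<close>, where neither is
  possible.
\<close>

lemma basis_elem_in_submodule:
  fixes M :: "'c::comm_ring_1 eps_alg set"
  assumes M: "sign_submodule n M" and one: "1 \<in> M"
    and S: "S \<subseteq> {..<n}" "even (card S)"
  shows "basis_elem n S \<in> M"
  using S
proof (induction "\<Sum>S" arbitrary: S rule: less_induct)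
  case less
  have act: "sign_action n (transpose a (Suc a)) x \<in> M" if "x \<in> M" "Suc a < n" for a x
  proof -
    have "transpose a (Suc a) permutes {..<n}"
      using that by (intro permutes_swap_id) simp_all
    then show ?thesis
      using M that unfolding sign_submodule_def by blast
  qed
  have fin: "finite S"
    using less.prems finite_subset by blast
  show ?case
  proof (cases "S = {}")
    case True
    then show ?thesis using one by simp
  next
    case False
    define m where "m = Max S"
    have m: "m \<in> S" "\<And>x. x \<in> S \<Longrightarrow> x \<le> m"
      using False fin by (simp_all add: m_def)
    have "m \<noteq> 0"
    proof
      assume "m = 0"
      then have "S = {0}"
        using m by auto
      then show False
        using less.prems by simp
    qed
    then obtain a where a: "m = Suc a"
      by (cases m) auto
    have an: "Suc a < n"
      using m a less.prems by auto
    show ?thesis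
    proof (cases "a \<in> S")
      case True
      define S' where "S' = S - {a, Suc a}"
      have S': "S = insert a (insert (Suc a) S')" "a \<notin> S'" "Suc a \<notin> S'" "finite S'"
        using True m a fin by (auto simp: S'_def)
      have "\<Sum>S' < \<Sum>S"
        using S' by simp
      then have in_M: "basis_elem n S' \<in> M"
        using less S' by simp
      have "basis_elem n S = basis_elem n S'
          - sign_action n (transpose a (Suc a)) (basis_elem n S')"
        using S' an by (simp add: sign_action_basis_elem_none)
      then show ?thesis
        using M in_M act[OF in_M an] eps_mod.subspace_diff
        by (metis sign_submodule_def)
    next
      case False
      let ?s = "transpose a (Suc a)"
      define S' where "S' = insert a (S - {Suc a})"
      have "\<Sum>S = Suc a + \<Sum>(S - {Suc a})" "\<Sum>S' = a + \<Sum>(S - {Suc a})"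
        using m a fin False sum.remove[of S "Suc a" "\<lambda>x. x"] by (simp_all add: S'_def)
      moreover have "card S' = card S"
        using m a fin False card.remove[of S "Suc a"] by (simp add: S'_def)
      moreover have "S' \<subseteq> {..<n}"
        using less.prems an by (auto simp: S'_def)
      ultimately have in_M: "basis_elem n S' \<in> M"
        using less by simp
      have "?s ` S' = S"
      proof (rule set_eqI)
        show "x \<in> ?s ` S' \<longleftrightarrow> x \<in> S" for x
          using m a False by (auto simp: in_transpose_image_iff S'_def transpose_def)
      qed
      moreover have "finite S'" "(a \<in> S') \<noteq> (Suc a \<in> S')"
        using fin by (simp_all add: S'_def)
      ultimately have "(basis_elem n S :: 'c eps_alg) = sign_action n ?s (basis_elem n S')"
        using an by (simp add: sign_action_basis_elem_one)
      then show ?thesis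
        using act[OF in_M an] by simp
    qed
  qed
qed

lemma span_basis_elem_eq_eps_module:
  "eps_mod.span (basis_elem n ` {S. S \<subseteq> {..<n} \<and> even (card S)}) = eps_module n"
  (is "eps_mod.span ?B = _")
  unfolding eps_module_def
proof (rule hull_unique[symmetric])
  have "1 \<in> ?B"
    by (rule image_eqI[of _ _ "{}"]) simp_all
  then show "{1} \<subseteq> eps_mod.span ?B"
    by (simp add: eps_mod.span_base)
next
  show "sign_submodule n (eps_mod.span ?B)"
  proof (rule sign_submodule_span)
    fix x :: "'a eps_alg" and a
    assume "x \<in> ?B" and a: "Suc a < n"
    then obtain S where S: "x = basis_elem n S" "S \<subseteq> {..<n}" "even (card S)"
      by auto
    have fin: "finite S"
      using S finite_subset by blast
    let ?s = "transpose a (Suc a)"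
    have span: "basis_elem n T \<in> eps_mod.span ?B" if "T \<subseteq> {..<n}" "even (card T)" for T
      using that by (intro eps_mod.span_base) auto
    consider "a \<in> S" "Suc a \<in> S" | "(a \<in> S) \<noteq> (Suc a \<in> S)" | "a \<notin> S" "Suc a \<notin> S"
      by blast
    then show "sign_action n ?s x \<in> eps_mod.span ?B"
    proof cases
      case 1
      then show ?thesis
        using S span a fin by (simp add: sign_action_basis_elem_both eps_mod.span_neg)
    next
      case 2
      have "?s permutes {..<n}"
        using a by (intro permutes_swap_id) auto
      then have "?s ` S \<subseteq> {..<n}"
        using S by (metis image_mono permutes_image)
      moreover have "card (?s ` S) = card S"
        by (simp add: card_image)
      ultimately show ?thesis
        using 2 S span a fin by (simp add: sign_action_basis_elem_one)
    next
      case 3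
      then show ?thesis
        using S span a fin by (simp add: sign_action_basis_elem_none eps_mod.span_diff)
    qed
  qed
next
  fix M :: "'a eps_alg set"
  assume "{1} \<subseteq> M" "sign_submodule n M"
  then show "eps_mod.span ?B \<subseteq> M"
    by (intro eps_mod.span_minimal) (auto simp: sign_submodule_def intro: basis_elem_in_submodule)
qed

lemma card_even_subsets:
  assumes "n \<ge> 1"
  shows "card {S. S \<subseteq> {..<n} \<and> even (card S)} = 2 ^ (n - 1)"
proof -
  let ?E = "{S. S \<subseteq> {..<n} \<and> even (card S)}" and ?O = "{S. S \<subseteq> {..<n} \<and> odd (card S)}"
  have "0 \<in> {..<n}"
    using assms by simp
  then have "{} \<subset> {..<n}"
    by blast
  then have "card ?E = card ?O"
    using card_subsupersets_even_odd[of "{..<n}" "{}"] by simp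
  moreover have "card ?E + card ?O = card (Pow {..<n})"
    by (subst card_Un_disjoint[symmetric]) (auto intro: arg_cong[where f = card])
  ultimately have "2 * card ?E = 2 ^ n"
    by (simp add: card_Pow)
  then show ?thesis
    using assms by (cases n) simp_all
qed

theorem theorem2p28:
  fixes n :: nat
  assumes "n \<ge> 1"
  shows "\<exists>B :: 'c::comm_ring_1 eps_alg set.
    eps_mod.independent B \<and> eps_mod.span B = eps_module n \<and> card B = 2 ^ (n - 1)"
proof (intro exI conjI)
  let ?\<S> = "{S. S \<subseteq> {..<n} \<and> even (card S)}"
  let ?B = "basis_elem n ` ?\<S> :: 'c eps_alg set"
  have sub: "?\<S> \<subseteq> Pow {..<n}"
    by auto
  show "eps_mod.independent ?B"
    using sub by (rule independent_basis_elem)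
  show "eps_mod.span ?B = eps_module n"
    by (rule span_basis_elem_eq_eps_module)
  show "card ?B = 2 ^ (n - 1)"
    using assms by (simp add: card_image[OF inj_on_subset[OF inj_on_basis_elem sub]]
        card_even_subsets)
qed

end
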